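(* Let $f:\mathbb{R}^n\to\mathbb{R}$ be $\nu$-smooth and $\mu$-strongly convex, let $X=[X_1,\dots,X_p]\in\mathbb{R}^{n\times p}$ have nonzero columns, and let $\Omega=\|\cdot\|_1$ on $\mathbb{R}^p$. Let $0<\lambda\le\lambda_t$, let $\beta_t\in\mathbb{R}^p$, and let $\theta_t$ be the associated rescaled dual feasible vector at parameter $\lambda_t$. For any $\lambda'\in[\lambda,\lambda_t]$ the following hold. 1. For any $j\in\{1,\dots,p\}$ such that $d_j^2(\theta_t)>2\nu\,\mathcal{E}'_t$: $$\text{if }\ \lambda'\le\frac{\lambda_t\|\theta_t\|}{\|\theta_t\|+\sqrt{d_j^2(\theta_t)-2\nu\,\mathcal{E}'_t}},\ \text{ then } j\in\mathcal{A}_t(\lambda').$$ 2. For any $j\in\{1,\dots,p\}$ such that $d_j^2(\theta_t)>2\nu\,\mathcal{E}''_t$: $$\text{if } j\in\mathcal{A}_t(\lambda'),\ \text{ then }\ \lambda'\le\frac{\lambda_t\|\theta_t\|}{\|\theta_t\|+\sqrt{\frac{\mu}{\nu}\left(d_j^2(\theta_t)-2\nu\,\mathcal{E}''_t\right)}}.$$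
   Context: Norms on $\mathbb{R}^n$ are Euclidean. A differentiable function $f$ is $\nu$-smooth and $\mu$-strongly convex ($0<\mu\le\nu$) if for all $z,z_0$: $\frac{\mu}{2}\|z-z_0\|^2\le f(z)-f(z_0)-\langle\nabla f(z_0),z-z_0\rangle\le\frac{\nu}{2}\|z-z_0\|^2$. The Fenchel conjugate is $f^*(u)=\sup_{x}\langle u,x\rangle-f(x)$. For $\gamma>0$: $P_\gamma(\beta)=f(X\beta)+\gamma\|\beta\|_1$; a vector $\theta\in\mathbb{R}^n$ is dual feasible if $|X_j^\top\theta|\le1$ for all $j$; for feasible $\theta$ the dual objective is $D_\gamma(\theta)=-f^*(-\gamma\theta)$; the duality gap is $\mathrm{Gap}_\gamma(\beta,\theta)=P_\gamma(\beta)-D_\gamma(\theta)$. The rescaled dual vector is $\theta_t=-\nabla f(X\beta_t)/\alpha_t$ with $\alpha_t=\max(\lambda_t,\|X^\top\nabla f(X\beta_t)\|_\infty)$. Further notation: $\zeta_t=-\lambda_t\theta_t$; $\mathrm{Gap}_t=\mathrm{Gap}_{\lambda_t}(\beta_t,\theta_t)$; $\Delta_t=f(X\beta_t)-f(\nabla f^*(\zeta_t))$; $$\mathcal{E}'_t=\frac{1}{\lambda_t^2}\mathrm{Gap}_t+\left(\frac1{\lambda^2}-\frac1{\lambda_t^2}\right)\min(0,\Delta_t),\qquad \mathcal{E}''_t=\frac{1}{\lambda\lambda_t}\mathrm{Gap}_t+\left(\frac1{\lambda^2}-\frac1{\lambda_t^2}\right)\max(0,\Delta_t).$$ $d_j(\theta)=\dfrac{1-|X_j^\top\theta|}{\|X_j\|}$;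 for $\gamma>0$, the safe radius is $r_t(\gamma)=\sqrt{\frac{2\nu}{\gamma^2}\mathrm{Gap}_\gamma(\beta_t,\theta_t)}$ and the sequential safe active set is $\mathcal{A}_t(\gamma)=\{j\in\{1,\dots,p\}: d_j(\theta_t)\le r_t(\gamma)\}$. *)

theory Defs
  imports "HOL-Analysis.Analysis"
begin

definition gradient :: "('a::real_inner \<Rightarrow> real) \<Rightarrow> 'a \<Rightarrow> 'a" where
  "gradient f x = (THE g. GDERIV f x :> g)"

lemma gradient_eqI:
  fixes f :: "'a::real_inner \<Rightarrow> real"
  assumes "GDERIV f x :> g"
  shows "gradient f x = g"
  unfolding gradient_def
proof (rule the_equality)
  show "GDERIV f x :> g" by (rule assms)
next
  fix g' assume "GDERIV f x :> g'"
  with assms have "(\<lambda>h. h \<bullet> g') = (\<lambda>h. h \<bullet> g)"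
    unfolding gderiv_def by (rule has_derivative_unique[rotated])
  then have "h \<bullet> g' = h \<bullet> g" for h by (rule fun_cong)
  then show "g' = g" using vector_eq_ldot by blast
qed

lemma GDERIV_gradient:
  fixes f :: "'a::euclidean_space \<Rightarrow> real"
  assumes "f differentiable (at x)"
  shows "GDERIV f x :> gradient f x"
proof -
  obtain D where D: "(f has_derivative D) (at x)"
    using assms by (auto simp: differentiable_def)
  interpret bounded_linear D by (rule has_derivative_bounded_linear[OF D])
  have "D = (\<lambda>h. h \<bullet> adjoint D 1)"
    using adjoint_works[OF linear_axioms, of _ 1] by (auto simp: fun_eq_iff)
  with D have "GDERIV f x :> adjoint D 1" by (simp add: gderiv_def)
  then show ?thesis by (simp add: gradient_eqI)
qed

definition smooth_strongly_convex :: "real \<Rightarrow> real \<Rightarrow> ('a::real_inner \<Rightarrow> real) \<Rightarrow> bool" where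
  "smooth_strongly_convex \<nu> \<mu> f \<longleftrightarrow>
     (\<forall>z. f differentiable (at z)) \<and>
     (\<forall>z z0. \<mu> / 2 * (norm (z - z0))\<^sup>2 \<le> f z - f z0 - gradient f z0 \<bullet> (z - z0) \<and>
             f z - f z0 - gradient f z0 \<bullet> (z - z0) \<le> \<nu> / 2 * (norm (z - z0))\<^sup>2)"

text \<open>
  The supremum is taken in the reals. It is the genuine supremum for the functions considered
  here, by the lemma following the definition; for a general \<open>f\<close> the set may be unbounded.
\<close>

definition fenchel_conjugate :: "('a::real_inner \<Rightarrow> real) \<Rightarrow> 'a \<Rightarrow> real" where
  "fenchel_conjugate f u = (SUP x. u \<bullet> x - f x)"

lemma bdd_above_fenchel_conjugate:
  fixes f :: "'a::real_inner \<Rightarrow> real"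
  assumes "smooth_strongly_convex \<nu> \<mu> f" "0 < \<mu>"
  shows "bdd_above (range (\<lambda>x. u \<bullet> x - f x))"
proof (rule bdd_aboveI2)
  fix x
  define g where "g = u - gradient f 0"
  have "\<mu> / 2 * (norm x)\<^sup>2 \<le> f x - f 0 - gradient f 0 \<bullet> x"
    using assms(1) unfolding smooth_strongly_convex_def by (metis diff_zero)
  moreover have "g \<bullet> x \<le> norm g * norm x" by (rule norm_cauchy_schwarz)
  moreover have "norm g * norm x \<le> (norm g)\<^sup>2 / (2 * \<mu>) + \<mu> / 2 * (norm x)\<^sup>2"
  proof -
    have "0 \<le> (norm g - \<mu> * norm x)\<^sup>2 / (2 * \<mu>)" using assms(2) by simp
    also have "\<dots> = (norm g)\<^sup>2 / (2 * \<mu>) + \<mu> / 2 * (norm x)\<^sup>2 - norm g * norm x"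
      using assms(2) by (simp add: field_simps power2_eq_square)
    finally show ?thesis by simp
  qed
  ultimately show "u \<bullet> x - f x \<le> (norm g)\<^sup>2 / (2 * \<mu>) - f 0"
    by (simp add: g_def inner_diff_left)
qed

definition l1_norm :: "real ^ 'p \<Rightarrow> real" where
  "l1_norm \<beta> = (\<Sum>j\<in>UNIV. \<bar>\<beta> $ j\<bar>)"

definition primal_obj :: "(real ^ 'n \<Rightarrow> real) \<Rightarrow> real ^ 'p ^ 'n \<Rightarrow> real \<Rightarrow> real ^ 'p \<Rightarrow> real" where
  "primal_obj f X \<gamma> \<beta> = f (X *v \<beta>) + \<gamma> * l1_norm \<beta>"

definition dual_feasible :: "real ^ 'p ^ 'n \<Rightarrow> real ^ 'n \<Rightarrow> bool" where
  "dual_feasible X \<theta> \<longleftrightarrow> (\<forall>j. \<bar>column j X \<bullet> \<theta>\<bar> \<le> 1)"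

definition dual_obj :: "(real ^ 'n \<Rightarrow> real) \<Rightarrow> real \<Rightarrow> real ^ 'n \<Rightarrow> real" where
  "dual_obj f \<gamma> \<theta> = - fenchel_conjugate f (- (\<gamma> *\<^sub>R \<theta>))"

definition duality_gap ::
  "(real ^ 'n \<Rightarrow> real) \<Rightarrow> real ^ 'p ^ 'n \<Rightarrow> real \<Rightarrow> real ^ 'p \<Rightarrow> real ^ 'n \<Rightarrow> real" where
  "duality_gap f X \<gamma> \<beta> \<theta> = primal_obj f X \<gamma> \<beta> - dual_obj f \<gamma> \<theta>"

definition rescaled_dual ::
  "(real ^ 'n \<Rightarrow> real) \<Rightarrow> real ^ 'p ^ 'n \<Rightarrow> real \<Rightarrow> real ^ 'p \<Rightarrow> real ^ 'n" where
  "rescaled_dual f X \<gamma> \<beta> =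
     - (gradient f (X *v \<beta>) /\<^sub>R max \<gamma> (infnorm (transpose X *v gradient f (X *v \<beta>))))"

lemma dual_feasible_rescaled_dual:
  assumes "0 < \<gamma>"
  shows "dual_feasible X (rescaled_dual f X \<gamma> \<beta>)"
  unfolding dual_feasible_def
proof
  fix j
  define g where "g = gradient f (X *v \<beta>)"
  define a where "a = max \<gamma> (infnorm (transpose X *v g))"
  have "column j X \<bullet> g = (transpose X *v g) $ j"
    by (simp add: matrix_vector_mult_def inner_vec_def column_def transpose_def)
  then have "\<bar>column j X \<bullet> g\<bar> \<le> a"
    using component_le_infnorm_cart[of "transpose X *v g" j] by (simp add: a_def)
  moreover have "0 < a" using assms by (simp add: a_def)
  moreover have "rescaled_dual f X \<gamma> \<beta> = - (g /\<^sub>R a)"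
    by (simp add: rescaled_dual_def a_def g_def)
  ultimately show "\<bar>column j X \<bullet> rescaled_dual f X \<gamma> \<beta>\<bar> \<le> 1"
    by (simp add: abs_mult field_simps)
qed

text \<open>
  \<open>primal_diff\<close>, \<open>err_lower\<close> and \<open>err_upper\<close> correspond to \<open>\<Delta>\<^sub>t\<close>, \<open>E'\<^sub>t\<close> and \<open>E''\<^sub>t\<close>. The
  point \<open>- (lam\<^sub>t *\<^sub>R \<theta>)\<close> is \<open>\<zeta>\<^sub>t\<close>; the gradient of the conjugate exists there because the
  conjugate of a strongly convex differentiable function is differentiable.
\<close>

definition primal_diff ::
  "(real ^ 'n \<Rightarrow> real) \<Rightarrow> real ^ 'p ^ 'n \<Rightarrow> real \<Rightarrow> real ^ 'p \<Rightarrow> real ^ 'n \<Rightarrow> real" where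
  "primal_diff f X lam\<^sub>t \<beta> \<theta> =
     f (X *v \<beta>) - f (gradient (fenchel_conjugate f) (- (lam\<^sub>t *\<^sub>R \<theta>)))"

definition err_lower ::
  "(real ^ 'n \<Rightarrow> real) \<Rightarrow> real ^ 'p ^ 'n \<Rightarrow> real \<Rightarrow> real \<Rightarrow> real ^ 'p \<Rightarrow> real ^ 'n \<Rightarrow> real" where
  "err_lower f X lam lam\<^sub>t \<beta> \<theta> =
     1 / lam\<^sub>t\<^sup>2 * duality_gap f X lam\<^sub>t \<beta> \<theta>
     + (1 / lam\<^sup>2 - 1 / lam\<^sub>t\<^sup>2) * min 0 (primal_diff f X lam\<^sub>t \<beta> \<theta>)"

definition err_upper ::
  "(real ^ 'n \<Rightarrow> real) \<Rightarrow> real ^ 'p ^ 'n \<Rightarrow> real \<Rightarrow> real \<Rightarrow> real ^ 'p \<Rightarrow> real ^ 'n \<Rightarrow> real" where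
  "err_upper f X lam lam\<^sub>t \<beta> \<theta> =
     1 / (lam * lam\<^sub>t) * duality_gap f X lam\<^sub>t \<beta> \<theta>
     + (1 / lam\<^sup>2 - 1 / lam\<^sub>t\<^sup>2) * max 0 (primal_diff f X lam\<^sub>t \<beta> \<theta>)"

definition screening_dist :: "real ^ 'p ^ 'n \<Rightarrow> 'p \<Rightarrow> real ^ 'n \<Rightarrow> real" where
  "screening_dist X j \<theta> = (1 - \<bar>column j X \<bullet> \<theta>\<bar>) / norm (column j X)"

definition safe_radius ::
  "real \<Rightarrow> (real ^ 'n \<Rightarrow> real) \<Rightarrow> real ^ 'p ^ 'n \<Rightarrow> real ^ 'p \<Rightarrow> real ^ 'n \<Rightarrow> real \<Rightarrow> real" where
  "safe_radius \<nu> f X \<beta> \<theta> \<gamma> = sqrt (2 * \<nu> / \<gamma>\<^sup>2 * duality_gap f X \<gamma> \<beta> \<theta>)"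

definition safe_active_set ::
  "real \<Rightarrow> (real ^ 'n \<Rightarrow> real) \<Rightarrow> real ^ 'p ^ 'n \<Rightarrow> real ^ 'p \<Rightarrow> real ^ 'n \<Rightarrow> real \<Rightarrow> 'p set" where
  "safe_active_set \<nu> f X \<beta> \<theta> \<gamma> =
     {j. screening_dist X j \<theta> \<le> safe_radius \<nu> f X \<beta> \<theta> \<gamma>}"

end

theory Submission
  imports Defs
begin

text \<open>
  The conjugate of \<open>f\<close> is \<open>1/\<nu>\<close>-strongly convex and \<open>1/\<mu>\<close>-smooth. Along the ray from
  \<open>\<zeta>\<^sub>t\<close> to \<open>\<rho> \<zeta>\<^sub>t\<close> with \<open>\<rho> = lam' / lam\<^sub>t\<close>, using \<open>\<nabla>f\<^sup>*(\<zeta>\<^sub>t) \<bullet> \<zeta>\<^sub>t = f\<^sup>*(\<zeta>\<^sub>t) + f(\<nabla>f\<^sup>*(\<zeta>\<^sub>t))\<close>,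
  this says that the gap at \<open>lam'\<close> equals \<open>\<rho> Gap\<^sub>t + (1 - \<rho>) \<Delta>\<^sub>t\<close> up to a remainder between
  \<open>(1 - \<rho>)\<^sup>2 \<parallel>\<zeta>\<^sub>t\<parallel>\<^sup>2 / (2\<nu>)\<close> and \<open>(1 - \<rho>)\<^sup>2 \<parallel>\<zeta>\<^sub>t\<parallel>\<^sup>2 / (2\<mu>)\<close>. After division by \<open>lam'\<^sup>2\<close>
  the remainder becomes a multiple of \<open>(lam\<^sub>t / lam' - 1)\<^sup>2 \<parallel>\<theta>\<^sub>t\<parallel>\<^sup>2\<close>, the other terms are bounded by
  the two error terms uniformly in \<open>lam'\<close>, and one solves for \<open>lam'\<close>.
\<close>

section \<open>Conjugates of smooth strongly convex functions\<close>

lemma smooth_strongly_convexD: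
  assumes "smooth_strongly_convex \<nu> \<mu> f"
  shows "f differentiable (at z)"
    and "\<mu> / 2 * (norm (z - z0))\<^sup>2 \<le> f z - f z0 - gradient f z0 \<bullet> (z - z0)"
    and "f z - f z0 - gradient f z0 \<bullet> (z - z0) \<le> \<nu> / 2 * (norm (z - z0))\<^sup>2"
  using assms unfolding smooth_strongly_convex_def by blast+

lemma fenchel_young:
  assumes "smooth_strongly_convex \<nu> \<mu> f" "0 < \<mu>"
  shows "u \<bullet> x - f x \<le> fenchel_conjugate f u"
  unfolding fenchel_conjugate_def
  using bdd_above_fenchel_conjugate[OF assms] by (intro cSUP_upper) auto

lemma young_inequality:
  fixes a b c :: real
  assumes "0 < c"
  shows "a * b \<le> a\<^sup>2 / (2 * c) + c / 2 * b\<^sup>2"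
proof -
  have "0 \<le> (a - c * b)\<^sup>2 / (2 * c)" using assms by simp
  also have "\<dots> = a\<^sup>2 / (2 * c) + c / 2 * b\<^sup>2 - a * b"
    using assms by (simp add: field_simps power2_eq_square)
  finally show ?thesis by simp
qed

text \<open>A gradient ascent step of length \<open>1 / \<nu>\<close> for the concave objective
  behind the conjugate; smoothness guarantees the gain. At a maximizer the gain must vanish, and
  started elsewhere it bounds the conjugate from below.\<close>

lemma ascent_step:
  fixes u x :: "'a::real_inner"
  assumes "smooth_strongly_convex \<nu> \<mu> f" "0 < \<nu>"
  defines "y \<equiv> x + (u - gradient f x) /\<^sub>R \<nu>"
  shows "u \<bullet> x - f x + (norm (u - gradient f x))\<^sup>2 / (2 * \<nu>) \<le> u \<bullet> y - f y"
proof -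
  define g where "g = u - gradient f x"
  have y: "y - x = g /\<^sub>R \<nu>" by (simp add: y_def g_def)
  have "f y - f x - gradient f x \<bullet> (y - x) \<le> \<nu> / 2 * (norm (y - x))\<^sup>2"
    by (rule smooth_strongly_convexD(3)[OF assms(1)])
  moreover have "gradient f x \<bullet> (y - x) = u \<bullet> y - u \<bullet> x - g \<bullet> (y - x)"
    by (simp add: g_def inner_diff_left inner_diff_right)
  moreover have "g \<bullet> (y - x) = (norm g)\<^sup>2 / \<nu>"
    by (simp add: y dot_square_norm divide_inverse)
  moreover have "\<nu> / 2 * (norm (y - x))\<^sup>2 = (norm g)\<^sup>2 / (2 * \<nu>)"
    using assms(2) by (simp add: y power_mult_distrib power2_eq_square field_simps)
  moreover have "(norm g)\<^sup>2 / \<nu> = 2 * ((norm g)\<^sup>2 / (2 * \<nu>))" by simp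
  ultimately show ?thesis unfolding g_def[symmetric] by linarith
qed

text \<open>Strong convexity keeps the objective outside a large ball below its value at 0, so a
  maximizer over the compact ball is global.\<close>

lemma conjugate_maximizer_exists:
  fixes f :: "'a::euclidean_space \<Rightarrow> real"
  assumes f: "smooth_strongly_convex \<nu> \<mu> f" and "0 < \<mu>"
  shows "\<exists>x. \<forall>y. u \<bullet> y - f y \<le> u \<bullet> x - f x"
proof -
  define h where "h = (\<lambda>x. u \<bullet> x - f x)"
  define g where "g = u - gradient f 0"
  \<comment> \<open>Beyond this radius \<open>\<mu> / 2 * (norm y)\<^sup>2\<close> dominates the
    linear term \<open>norm g * norm y\<close>.\<close>
  define R where "R = 2 * norm g / \<mu>"
  have "0 \<le> R" using assms(2) by (simp add: R_def)
  have "continuous_on (cball 0 R) h"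
    unfolding h_def using smooth_strongly_convexD(1)[OF f]
    by (intro continuous_intros continuous_at_imp_continuous_on)
       (auto intro: differentiable_imp_continuous_within)
  then obtain x where x: "\<And>y. y \<in> cball 0 R \<Longrightarrow> h y \<le> h x"
    using continuous_attains_sup[of "cball 0 R" h] \<open>0 \<le> R\<close> by fastforce
  have "h y \<le> h x" for y
  proof (cases "y \<in> cball 0 R")
    case False
    then have "2 * norm g \<le> \<mu> * norm y"
      using assms(2) by (simp add: R_def field_simps)
    then have "2 * norm g * norm y \<le> \<mu> * norm y * norm y" by (intro mult_right_mono) auto
    moreover have "g \<bullet> y \<le> norm g * norm y" by (rule norm_cauchy_schwarz)
    moreover have "\<mu> / 2 * (norm (y - 0))\<^sup>2 \<le> f y - f 0 - gradient f 0 \<bullet> (y - 0)"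
      by (rule smooth_strongly_convexD(2)[OF f])
    ultimately have "h y \<le> h 0"
      by (simp add: h_def g_def inner_diff_left power2_eq_square)
    also have "h 0 \<le> h x" using \<open>0 \<le> R\<close> by (intro x) simp
    finally show ?thesis .
  qed (rule x)
  then show ?thesis unfolding h_def by blast
qed

lemma conjugate_eq_at_maximizer:
  assumes "smooth_strongly_convex \<nu> \<mu> f" "0 < \<mu>"
    and "\<And>y. u \<bullet> y - f y \<le> u \<bullet> x - f x"
  shows "fenchel_conjugate f u = u \<bullet> x - f x"
proof (rule antisym)
  show "fenchel_conjugate f u \<le> u \<bullet> x - f x"
    unfolding fenchel_conjugate_def using assms(3) by (intro cSUP_least) auto
qed (rule fenchel_young[OF assms(1,2)])

lemma gradient_at_maximizer:
  assumes f: "smooth_strongly_convex \<nu> \<mu> f" and "0 < \<nu>"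
    and max: "\<And>y. u \<bullet> y - f y \<le> u \<bullet> x - f x"
  shows "gradient f x = u"
proof -
  have "(norm (u - gradient f x))\<^sup>2 / (2 * \<nu>) \<le> 0"
    using ascent_step[OF f \<open>0 < \<nu>\<close>, of u x] max[of "x + (u - gradient f x) /\<^sub>R \<nu>"] by linarith
  then show ?thesis using \<open>0 < \<nu>\<close> by (simp add: divide_le_0_iff)
qed

text \<open>Here \<open>x\<close> acts as the gradient of the conjugate at \<open>u\<close>. For the
  lower bound, an ascent step from \<open>x\<close> for the slope \<open>v\<close> is a test point
  in the supremum. For the upper bound, \<open>f\<close> is replaced by its strong convexity
  minorant at \<open>x\<close>, and Young's inequality bounds what remains.\<close>

lemma conjugate_quadratic_bounds:
  assumes f: "smooth_strongly_convex \<nu> \<mu> f" and "0 < \<mu>" "0 < \<nu>"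
    and max: "\<And>y. u \<bullet> y - f y \<le> u \<bullet> x - f x"
  shows "(norm (v - u))\<^sup>2 / (2 * \<nu>)
           \<le> fenchel_conjugate f v - fenchel_conjugate f u - (v - u) \<bullet> x"
    and "fenchel_conjugate f v - fenchel_conjugate f u - (v - u) \<bullet> x
           \<le> (norm (v - u))\<^sup>2 / (2 * \<mu>)"
proof -
  have g: "gradient f x = u" by (rule gradient_at_maximizer[OF f \<open>0 < \<nu>\<close> max])
  have c: "fenchel_conjugate f u = u \<bullet> x - f x"
    by (rule conjugate_eq_at_maximizer[OF f \<open>0 < \<mu>\<close> max])
  have "v \<bullet> x - f x + (norm (v - u))\<^sup>2 / (2 * \<nu>) \<le> fenchel_conjugate f v"
    using ascent_step[OF f \<open>0 < \<nu>\<close>, of v x] fenchel_young[OF f \<open>0 < \<mu>\<close>] unfolding g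
    by (rule order_trans)
  then show "(norm (v - u))\<^sup>2 / (2 * \<nu>)
           \<le> fenchel_conjugate f v - fenchel_conjugate f u - (v - u) \<bullet> x"
    by (simp add: c inner_diff_left)
  have "v \<bullet> y - f y \<le> v \<bullet> x - f x + (norm (v - u))\<^sup>2 / (2 * \<mu>)" for y
  proof -
    have "\<mu> / 2 * (norm (y - x))\<^sup>2 \<le> f y - f x - u \<bullet> (y - x)"
      using smooth_strongly_convexD(2)[OF f, of y x] by (simp add: g)
    moreover have "(v - u) \<bullet> (y - x) \<le> norm (v - u) * norm (y - x)"
      by (rule norm_cauchy_schwarz)
    moreover have "\<dots> \<le> (norm (v - u))\<^sup>2 / (2 * \<mu>) + \<mu> / 2 * (norm (y - x))\<^sup>2"
      by (rule young_inequality[OF \<open>0 < \<mu>\<close>])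
    ultimately show ?thesis by (simp add: inner_diff_left inner_diff_right)
  qed
  then have "fenchel_conjugate f v \<le> v \<bullet> x - f x + (norm (v - u))\<^sup>2 / (2 * \<mu>)"
    unfolding fenchel_conjugate_def by (intro cSUP_least) auto
  then show "fenchel_conjugate f v - fenchel_conjugate f u - (v - u) \<bullet> x
           \<le> (norm (v - u))\<^sup>2 / (2 * \<mu>)"
    by (simp add: c inner_diff_left)
qed

lemma GDERIV_if_quadratic_bound:
  fixes f :: "'a::real_inner \<Rightarrow> real"
  assumes "\<And>v. \<bar>f v - f u - (v - u) \<bullet> x\<bar> \<le> C * (norm (v - u))\<^sup>2"
  shows "GDERIV f u :> x"
  unfolding gderiv_def has_derivative_at
proof (intro conjI)
  show "bounded_linear (\<lambda>h. h \<bullet> x)" by (rule bounded_linear_inner_left)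
  have lim: "((\<lambda>h. C * norm h) \<longlongrightarrow> 0) (at (0::'a))"
    by (intro tendsto_mult_right_zero tendsto_norm_zero tendsto_ident_at)
  show "(\<lambda>h. norm (f (u + h) - f u - h \<bullet> x) / norm h) \<midarrow>0\<rightarrow> 0"
  proof (rule Lim_null_comparison[OF _ lim], intro always_eventually allI)
    fix h :: 'a
    show "norm (norm (f (u + h) - f u - h \<bullet> x) / norm h) \<le> C * norm h"
      using assms[of "u + h"]
      \<comment> \<open>At \<open>h = 0\<close> the quotient is 0, by the convention for division by
        zero.\<close>
      by (cases "h = 0") (auto simp: divide_le_eq power2_eq_square mult_ac)
  qed
qed

text \<open>This makes \<open>primal_diff\<close> computable: the abstract gradient in its
  definition becomes a concrete maximizer.\<close>

lemma gradient_fenchel_conjugate_at_maximizer: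
  assumes "smooth_strongly_convex \<nu> \<mu> f" "0 < \<mu>" "0 < \<nu>"
    and "\<And>y. u \<bullet> y - f y \<le> u \<bullet> x - f x"
  shows "gradient (fenchel_conjugate f) u = x"
proof (rule gradient_eqI, rule GDERIV_if_quadratic_bound)
  fix v
  note b = conjugate_quadratic_bounds[OF assms, of v]
  \<comment> \<open>The remainder is nonnegative, so its upper bound also bounds its absolute
    value.\<close>
  have "0 \<le> (norm (v - u))\<^sup>2 / (2 * \<nu>)" using assms(3) by simp
  with b show "\<bar>fenchel_conjugate f v - fenchel_conjugate f u - (v - u) \<bullet> x\<bar>
    \<le> 1 / (2 * \<mu>) * (norm (v - u))\<^sup>2" by simp
qed

section \<open>The duality gap as a function of the parameter\<close>

lemma weak_duality:
  assumes f: "smooth_strongly_convex \<nu> \<mu> f" and "0 < \<mu>"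
    and feas: "dual_feasible X \<theta>" and "0 \<le> \<gamma>"
  shows "0 \<le> duality_gap f X \<gamma> \<beta> \<theta>"
proof -
  have "\<theta> \<bullet> (X *v \<beta>) = (\<Sum>j\<in>UNIV. \<beta> $ j * (column j X \<bullet> \<theta>))"
    by (simp add: matrix_mult_sum inner_sum_right inner_commute scalar_mult_eq_scaleR)
  also have "\<dots> \<le> l1_norm \<beta>"
    unfolding l1_norm_def
  proof (rule sum_mono)
    fix j
    have "\<beta> $ j * (column j X \<bullet> \<theta>) \<le> \<bar>\<beta> $ j\<bar> * \<bar>column j X \<bullet> \<theta>\<bar>"
      by (metis abs_ge_self abs_mult)
    also have "\<dots> \<le> \<bar>\<beta> $ j\<bar> * 1"
      using feas unfolding dual_feasible_def by (intro mult_left_mono) auto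
    finally show "\<beta> $ j * (column j X \<bullet> \<theta>) \<le> \<bar>\<beta> $ j\<bar>" by simp
  qed
  finally have "\<gamma> * (\<theta> \<bullet> (X *v \<beta>)) \<le> \<gamma> * l1_norm \<beta>"
    using \<open>0 \<le> \<gamma>\<close> by (rule mult_left_mono)
  moreover have "- (\<gamma> *\<^sub>R \<theta>) \<bullet> (X *v \<beta>) - f (X *v \<beta>) \<le> fenchel_conjugate f (- (\<gamma> *\<^sub>R \<theta>))"
    by (rule fenchel_young[OF f \<open>0 < \<mu>\<close>])
  ultimately show ?thesis
    by (simp add: duality_gap_def primal_obj_def dual_obj_def)
qed

text \<open>The middle quantity is the square of the safe radius at \<open>lam\<close>. The part
  \<open>main\<close> is exact; only the Bregman remainder \<open>R\<close> of the conjugate between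
  \<zeta> and its multiple by \<rho> is estimated.\<close>

lemma duality_gap_bounds:
  fixes f :: "real ^ 'n \<Rightarrow> real" and X :: "real ^ 'p ^ 'n"
    and \<beta> :: "real ^ 'p" and \<theta> :: "real ^ 'n"
  assumes f: "smooth_strongly_convex \<nu> \<mu> f" and "0 < \<mu>" "0 < \<nu>" and "0 < lam\<^sub>t" "0 < lam"
  defines "main \<equiv> 1 / (lam * lam\<^sub>t) * duality_gap f X lam\<^sub>t \<beta> \<theta>
                   + (1 / lam\<^sup>2 - 1 / (lam * lam\<^sub>t)) * primal_diff f X lam\<^sub>t \<beta> \<theta>"
  shows "2 * \<nu> * main + ((lam\<^sub>t / lam - 1) * norm \<theta>)\<^sup>2
           \<le> 2 * \<nu> / lam\<^sup>2 * duality_gap f X lam \<beta> \<theta>"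
    and "2 * \<nu> / lam\<^sup>2 * duality_gap f X lam \<beta> \<theta>
           \<le> 2 * \<nu> * main + \<nu> / \<mu> * ((lam\<^sub>t / lam - 1) * norm \<theta>)\<^sup>2"
proof -
  define \<rho> where "\<rho> = lam / lam\<^sub>t"
  define \<zeta> where "\<zeta> = - (lam\<^sub>t *\<^sub>R \<theta>)"
  have lam: "lam = \<rho> * lam\<^sub>t" using assms by (simp add: \<rho>_def)
  have \<zeta>': "- (lam *\<^sub>R \<theta>) = \<rho> *\<^sub>R \<zeta>" by (simp add: lam \<zeta>_def)
  obtain x where max: "\<And>y. \<zeta> \<bullet> y - f y \<le> \<zeta> \<bullet> x - f x"
    using conjugate_maximizer_exists[OF f \<open>0 < \<mu>\<close>] by blast
  have x: "gradient (fenchel_conjugate f) \<zeta> = x"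
    by (rule gradient_fenchel_conjugate_at_maximizer[OF f \<open>0 < \<mu>\<close> \<open>0 < \<nu>\<close> max])
  have c: "fenchel_conjugate f \<zeta> = \<zeta> \<bullet> x - f x"
    by (rule conjugate_eq_at_maximizer[OF f \<open>0 < \<mu>\<close> max])
  define R where
    "R = fenchel_conjugate f (\<rho> *\<^sub>R \<zeta>) - fenchel_conjugate f \<zeta> - (\<rho> *\<^sub>R \<zeta> - \<zeta>) \<bullet> x"
  have scaled: "duality_gap f X lam \<beta> \<theta>
      = \<rho> * duality_gap f X lam\<^sub>t \<beta> \<theta> + (1 - \<rho>) * primal_diff f X lam\<^sub>t \<beta> \<theta> + R"
    unfolding duality_gap_def primal_obj_def dual_obj_def primal_diff_def
      \<zeta>' \<zeta>_def[symmetric] x R_def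
    by (simp add: c lam inner_diff_left algebra_simps)
  have gap: "2 * \<nu> / lam\<^sup>2 * duality_gap f X lam \<beta> \<theta> = 2 * \<nu> * main + 2 * \<nu> / lam\<^sup>2 * R"
    using assms(4,5) unfolding scaled main_def \<rho>_def by (simp add: field_simps power2_eq_square)
  have "norm (\<rho> *\<^sub>R \<zeta> - \<zeta>) = \<bar>\<rho> - 1\<bar> * norm \<zeta>"
    by (metis norm_scaleR scaleR_left_diff_distrib scaleR_one)
  then have n: "(norm (\<rho> *\<^sub>R \<zeta> - \<zeta>))\<^sup>2 = lam\<^sup>2 * ((lam\<^sub>t / lam - 1) * norm \<theta>)\<^sup>2"
    using assms(4,5)
    by (simp add: \<zeta>_def \<rho>_def power_mult_distrib power2_eq_square[of "norm _"])
       (simp add: field_simps power2_eq_square)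
  note b = conjugate_quadratic_bounds[OF f \<open>0 < \<mu>\<close> \<open>0 < \<nu>\<close> max, of "\<rho> *\<^sub>R \<zeta>",
      folded R_def, unfolded n]
  \<comment> \<open>This factor turns the constants \<open>1 / (2 * \<nu>)\<close> and
    \<open>1 / (2 * \<mu>)\<close> into 1 and \<open>\<nu> / \<mu>\<close>, and cancels the
    \<open>lam\<^sup>2\<close> in \<open>n\<close>.\<close>
  have "0 \<le> 2 * \<nu> / lam\<^sup>2" using \<open>0 < \<nu>\<close> by simp
  note b' = b[THEN mult_left_mono, OF this]
  show "2 * \<nu> * main + ((lam\<^sub>t / lam - 1) * norm \<theta>)\<^sup>2
           \<le> 2 * \<nu> / lam\<^sup>2 * duality_gap f X lam \<beta> \<theta>"
    using b'(1) assms(3,5) unfolding gap by simp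
  show "2 * \<nu> / lam\<^sup>2 * duality_gap f X lam \<beta> \<theta>
           \<le> 2 * \<nu> * main + \<nu> / \<mu> * ((lam\<^sub>t / lam - 1) * norm \<theta>)\<^sup>2"
    using b'(2) assms(2,3,5) unfolding gap by simp
qed

section \<open>From gap bounds to thresholds for the parameter\<close>

lemma mult_bounds_min_max:
  fixes a b x :: real
  assumes "0 \<le> a" "a \<le> b"
  shows "b * min 0 x \<le> a * x" and "a * x \<le> b * max 0 x"
proof -
  have "b * min 0 x \<le> a * min 0 x" using assms by (intro mult_right_mono_neg) auto
  also have "\<dots> \<le> a * x" using assms by (intro mult_left_mono) auto
  finally show "b * min 0 x \<le> a * x" .
  have "a * x \<le> a * max 0 x" using assms by (intro mult_left_mono) auto
  also have "\<dots> \<le> b * max 0 x" using assms by (intro mult_right_mono) auto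
  finally show "a * x \<le> b * max 0 x" .
qed

text \<open>Solves the threshold inequality for \<open>s\<close>; \<open>0 < s\<close> keeps the
  denominator positive even when \<open>t = 0\<close>, that is, for a vanishing dual vector.\<close>

lemma threshold_iff:
  fixes t L l s :: real
  assumes "0 < l" "0 \<le> t" "0 < s"
  shows "l \<le> L * t / (t + s) \<longleftrightarrow> s \<le> (L / l - 1) * t"
  using assms by (simp add: pos_le_divide_eq) (simp add: field_simps)

theorem proposition3:
  fixes f :: "real ^ 'n \<Rightarrow> real"
    and X :: "real ^ 'p ^ 'n"
    and \<beta>\<^sub>t :: "real ^ 'p"
    and \<theta>\<^sub>t :: "real ^ 'n"
    and \<mu> \<nu> lam lam\<^sub>t lam' :: real
  assumes "0 < \<mu>" and "\<mu> \<le> \<nu>"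
    and "smooth_strongly_convex \<nu> \<mu> f"
    and "\<And>j. column j X \<noteq> 0"
    and "0 < lam" and "lam \<le> lam\<^sub>t"
    and "\<theta>\<^sub>t = rescaled_dual f X lam\<^sub>t \<beta>\<^sub>t"
    and "lam' \<in> {lam..lam\<^sub>t}"
  shows "(\<forall>j. (screening_dist X j \<theta>\<^sub>t)\<^sup>2 > 2 * \<nu> * err_lower f X lam lam\<^sub>t \<beta>\<^sub>t \<theta>\<^sub>t \<longrightarrow>
             lam' \<le> lam\<^sub>t * norm \<theta>\<^sub>t / (norm \<theta>\<^sub>t +
                    sqrt ((screening_dist X j \<theta>\<^sub>t)\<^sup>2 - 2 * \<nu> * err_lower f X lam lam\<^sub>t \<beta>\<^sub>t \<theta>\<^sub>t)) \<longrightarrow>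
             j \<in> safe_active_set \<nu> f X \<beta>\<^sub>t \<theta>\<^sub>t lam') \<and>
         (\<forall>j. (screening_dist X j \<theta>\<^sub>t)\<^sup>2 > 2 * \<nu> * err_upper f X lam lam\<^sub>t \<beta>\<^sub>t \<theta>\<^sub>t \<longrightarrow>
             j \<in> safe_active_set \<nu> f X \<beta>\<^sub>t \<theta>\<^sub>t lam' \<longrightarrow>
             lam' \<le> lam\<^sub>t * norm \<theta>\<^sub>t / (norm \<theta>\<^sub>t +
                    sqrt (\<mu> / \<nu> * ((screening_dist X j \<theta>\<^sub>t)\<^sup>2 - 2 * \<nu> * err_upper f X lam lam\<^sub>t \<beta>\<^sub>t \<theta>\<^sub>t))))"
proof -
  have "0 < \<nu>" using assms(1,2) by linarith
  have l: "0 < lam'" "lam \<le> lam'" "lam' \<le> lam\<^sub>t" "0 < lam\<^sub>t" using assms by auto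
  have feas: "dual_feasible X \<theta>\<^sub>t"
    unfolding assms(7) by (rule dual_feasible_rescaled_dual[OF l(4)])
  define G where "G = duality_gap f X lam\<^sub>t \<beta>\<^sub>t \<theta>\<^sub>t"
  define D where "D = primal_diff f X lam\<^sub>t \<beta>\<^sub>t \<theta>\<^sub>t"
  define m where "m = 1 / (lam' * lam\<^sub>t) * G + (1 / lam'\<^sup>2 - 1 / (lam' * lam\<^sub>t)) * D"
  define r where "r = 2 * \<nu> / lam'\<^sup>2 * duality_gap f X lam' \<beta>\<^sub>t \<theta>\<^sub>t"
  define q where "q = (lam\<^sub>t / lam' - 1) * norm \<theta>\<^sub>t"
  have r: "2 * \<nu> * m + q\<^sup>2 \<le> r" "r \<le> 2 * \<nu> * m + \<nu> / \<mu> * q\<^sup>2"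
    using duality_gap_bounds[OF assms(3,1) \<open>0 < \<nu>\<close> l(4,1)]
    unfolding r_def m_def q_def G_def D_def by blast+
  have "0 \<le> q" using l by (simp add: q_def)
  have "0 \<le> G"
    unfolding G_def using l by (intro weak_duality[OF assms(3,1) feas]) simp
  \<comment> \<open>As \<open>lam'\<close> varies, the weight of \<open>G\<close> is smallest at
    \<open>lam\<^sub>t\<close> and largest at \<open>lam\<close>.\<close>
  have G: "1 / lam\<^sub>t\<^sup>2 * G \<le> 1 / (lam' * lam\<^sub>t) * G" "1 / (lam' * lam\<^sub>t) * G \<le> 1 / (lam * lam\<^sub>t) * G"
    using l assms(5) \<open>0 \<le> G\<close>
    by (auto intro!: mult_right_mono divide_left_mono simp: power2_eq_square)
  have a: "0 \<le> 1 / lam'\<^sup>2 - 1 / (lam' * lam\<^sub>t)"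
    using l by (auto intro!: divide_left_mono mult_left_mono simp: power2_eq_square)
  have "1 / lam'\<^sup>2 \<le> 1 / lam\<^sup>2" "1 / lam\<^sub>t\<^sup>2 \<le> 1 / (lam' * lam\<^sub>t)"
    using l assms(5) by (auto intro!: divide_left_mono mult_mono simp: power2_eq_square)
  then have "1 / lam'\<^sup>2 - 1 / (lam' * lam\<^sub>t) \<le> 1 / lam\<^sup>2 - 1 / lam\<^sub>t\<^sup>2" by linarith
  \<comment> \<open>The weight of \<open>D\<close> lies between 0 and a bound free of
    \<open>lam'\<close>. Since the sign of \<open>D\<close> is unknown, uniform bounds need the
    \<open>min\<close> and \<open>max\<close> of the error terms.\<close>
  note D = mult_bounds_min_max[OF a this, of D]
  have m: "err_lower f X lam lam\<^sub>t \<beta>\<^sub>t \<theta>\<^sub>t \<le> m" "m \<le> err_upper f X lam lam\<^sub>t \<beta>\<^sub>t \<theta>\<^sub>t"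
    using G D unfolding err_lower_def err_upper_def m_def G_def D_def by (auto intro: add_mono)
  have m': "2 * \<nu> * err_lower f X lam lam\<^sub>t \<beta>\<^sub>t \<theta>\<^sub>t \<le> 2 * \<nu> * m"
    "2 * \<nu> * m \<le> 2 * \<nu> * err_upper f X lam lam\<^sub>t \<beta>\<^sub>t \<theta>\<^sub>t"
    using m \<open>0 < \<nu>\<close> by (simp_all add: mult_left_mono)
  \<comment> \<open>Feasibility makes the screening distance nonnegative, so comparing it with the
    radius amounts to comparing squares.\<close>
  have active: "j \<in> safe_active_set \<nu> f X \<beta>\<^sub>t \<theta>\<^sub>t lam' \<longleftrightarrow> (screening_dist X j \<theta>\<^sub>t)\<^sup>2 \<le> r" for j
  proof -
    have "0 \<le> screening_dist X j \<theta>\<^sub>t"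
      using feas by (simp add: screening_dist_def dual_feasible_def)
    then show ?thesis
      unfolding safe_active_set_def safe_radius_def r_def[symmetric] mem_Collect_eq
      using sqrt_ge_absD[of "screening_dist X j \<theta>\<^sub>t" r] by (auto intro: real_le_rsqrt)
  qed
  note threshold = threshold_iff[OF l(1) norm_ge_zero[of \<theta>\<^sub>t], of _ lam\<^sub>t, folded q_def]
  show ?thesis
  proof (intro conjI allI impI)
    fix j
    let ?s = "(screening_dist X j \<theta>\<^sub>t)\<^sup>2 - 2 * \<nu> * err_lower f X lam lam\<^sub>t \<beta>\<^sub>t \<theta>\<^sub>t"
    assume "2 * \<nu> * err_lower f X lam lam\<^sub>t \<beta>\<^sub>t \<theta>\<^sub>t < (screening_dist X j \<theta>\<^sub>t)\<^sup>2"
      and "lam' \<le> lam\<^sub>t * norm \<theta>\<^sub>t / (norm \<theta>\<^sub>t + sqrt ?s)"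
    then have "sqrt ?s \<le> q" by (subst (asm) threshold) auto
    then have "?s \<le> q\<^sup>2" by (rule sqrt_le_D)
    then show "j \<in> safe_active_set \<nu> f X \<beta>\<^sub>t \<theta>\<^sub>t lam'"
      using r(1) m'(1) unfolding active by linarith
  next
    fix j
    let ?s = "(screening_dist X j \<theta>\<^sub>t)\<^sup>2 - 2 * \<nu> * err_upper f X lam lam\<^sub>t \<beta>\<^sub>t \<theta>\<^sub>t"
    assume pos: "2 * \<nu> * err_upper f X lam lam\<^sub>t \<beta>\<^sub>t \<theta>\<^sub>t < (screening_dist X j \<theta>\<^sub>t)\<^sup>2"
      and "j \<in> safe_active_set \<nu> f X \<beta>\<^sub>t \<theta>\<^sub>t lam'"
    then have "?s \<le> \<nu> / \<mu> * q\<^sup>2"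
      using r(2) m'(2) unfolding active by linarith
    then have "\<mu> / \<nu> * ?s \<le> q\<^sup>2" using \<open>0 < \<mu>\<close> \<open>0 < \<nu>\<close> by (simp add: field_simps)
    then have "sqrt (\<mu> / \<nu> * ?s) \<le> q" by (rule real_le_lsqrt[OF \<open>0 \<le> q\<close>])
    \<comment> \<open>The strict hypothesis on the distance enters here, as \<open>threshold\<close>
      requires a positive root.\<close>
    moreover have "0 < sqrt (\<mu> / \<nu> * ?s)" using pos \<open>0 < \<mu>\<close> \<open>0 < \<nu>\<close> by simp
    ultimately show "lam' \<le> lam\<^sub>t * norm \<theta>\<^sub>t / (norm \<theta>\<^sub>t + sqrt (\<mu> / \<nu> * ?s))"
      by (subst threshold)
  qed
qed

end
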